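(* Let $f$ be an odd positive integer and $p\ge 0$ an integer with $f2^p>4$. A family of isonemal prefabric designs with rotational symmetry and order $f2^p$ exists (i.e. there is at least one isonemal prefabric of order $f2^p$ with rotational symmetry) if and only if $f$ is an (odd) sum of two relatively prime squares, $f=M^2+N^2$ with $\gcd(M,N)=1$, and $p\in\{0,1,2\}$.
   Context: The plane $E$ is tessellated by unit squares called cells, with horizontal and vertical sides. The strands are the vertical columns of cells (warps) and the horizontal rows of cells (wefts). A prefabric assigns to each cell which of the two strands crossing there is uppermost; its design colours a cell dark if the warp is uppermost and pale if the weft is. A symmetry is a pair $(g,\epsilon)$, where $g$ is an isometry of $E$ mapping the tessellation by cells to itself and $\epsilon\in\{e,\tau\}$: if $\epsilon=e$, $g$ carries the uppermost strand at each cell $c$ to the uppermost strand at $g(c)$; if $\epsilon=\tau$ (reversal of the two sides of $E$), $g$ carries the uppermost strand at $c$ to the lowermost strand at $g(c)$. The symmetries form the group $G$; $G_1$ is the planar group of all $g$ occurring in $G$. The prefabric is isonemal if $G$ is transitive on the strands. Its order is the least positive integer $n$ such that the over-under sequence along the strands repeats every $n$ cells. A prefabric has rotational symmetry if $G_1$ is of crystallographic type $p4$ (it contains quarter-turns and two independent translations, but no reflections or glide-reflections). *)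

theory Defs
  imports "HOL-Analysis.Analysis"
begin

text \<open>The Euclidean plane is the type \<^typ>\<open>complex\<close>. Column \<open>i\<close> is the warp
  \<open>i \<le> Re z \<le> i + 1\<close> and row \<open>j\<close> is the weft \<open>j \<le> Im z \<le> j + 1\<close>.\<close>

definition cell :: "int \<Rightarrow> int \<Rightarrow> complex set" where
  "cell i j = {z. of_int i \<le> Re z \<and> Re z \<le> of_int i + 1 \<and>
                  of_int j \<le> Im z \<and> Im z \<le> of_int j + 1}"

definition cells :: "complex set set" where
  "cells = {cell i j | i j. True}"

definition warp :: "int \<Rightarrow> complex set" where
  "warp i = (\<Union>j. cell i j)"

definition weft :: "int \<Rightarrow> complex set" where
  "weft j = (\<Union>i. cell i j)"

definition strands :: "complex set set" where
  "strands = range warp \<union> range weft"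

text \<open>A prefabric is identified with its design: \<open>D i j\<close> is true when the cell in column \<open>i\<close>
  and row \<open>j\<close> is dark, i.e. when the warp is uppermost there.\<close>

type_synonym prefabric = "int \<Rightarrow> int \<Rightarrow> bool"

definition uppermost :: "prefabric \<Rightarrow> int \<Rightarrow> int \<Rightarrow> complex set" where
  "uppermost D i j = (if D i j then warp i else weft j)"

definition lowermost :: "prefabric \<Rightarrow> int \<Rightarrow> int \<Rightarrow> complex set" where
  "lowermost D i j = (if D i j then weft j else warp i)"

definition tessellation_isometry :: "(complex \<Rightarrow> complex) \<Rightarrow> bool" where
  "tessellation_isometry g \<longleftrightarrow>
     (\<forall>z w. dist (g z) (g w) = dist z w) \<and> (\<lambda>c. g ` c) ` cells = cells"

text \<open>\<open>Reverse\<close> is the exchange \<open>\<tau>\<close> of the two sides of the plane, \<open>Preserve\<close> its absence.\<close>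

datatype side = Preserve | Reverse

definition symmetries :: "prefabric \<Rightarrow> ((complex \<Rightarrow> complex) \<times> side) set" where
  "symmetries D = {(g, \<epsilon>). tessellation_isometry g \<and>
     (\<forall>i j k l. g ` cell i j = cell k l \<longrightarrow>
        g ` uppermost D i j =
          (case \<epsilon> of Preserve \<Rightarrow> uppermost D k l | Reverse \<Rightarrow> lowermost D k l))}"

definition planar_group :: "prefabric \<Rightarrow> (complex \<Rightarrow> complex) set" where
  "planar_group D = fst ` symmetries D"

definition isonemal :: "prefabric \<Rightarrow> bool" where
  "isonemal D \<longleftrightarrow>
     (\<forall>s\<in>strands. \<forall>t\<in>strands. \<exists>(g, \<epsilon>)\<in>symmetries D. g ` s = t)"

text \<open>The first conjunct runs along the warps, the second along the wefts; along a weft the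
  over-under sequence is the pointwise negation of \<open>D\<close>, which has the same periods.\<close>

definition repeats_every :: "prefabric \<Rightarrow> nat \<Rightarrow> bool" where
  "repeats_every D n \<longleftrightarrow>
     (\<forall>i j. D i (j + int n) = D i j) \<and> (\<forall>i j. D (i + int n) j = D i j)"

definition has_order :: "prefabric \<Rightarrow> nat \<Rightarrow> bool" where
  "has_order D n \<longleftrightarrow>
     0 < n \<and> repeats_every D n \<and> (\<forall>m. 0 < m \<and> repeats_every D m \<longrightarrow> n \<le> m)"

definition quarter_turn :: "(complex \<Rightarrow> complex) \<Rightarrow> bool" where
  "quarter_turn g \<longleftrightarrow>
     (\<exists>c. g = (\<lambda>z. c + \<i> * (z - c)) \<or> g = (\<lambda>z. c - \<i> * (z - c)))"

definition line_reflection :: "complex \<Rightarrow> complex \<Rightarrow> complex \<Rightarrow> complex" where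
  \<comment> \<open>reflection in the line through \<open>c\<close> with unit direction \<open>u\<close>\<close>
  "line_reflection c u z = c + u\<^sup>2 * cnj (z - c)"

definition reflection :: "(complex \<Rightarrow> complex) \<Rightarrow> bool" where
  "reflection g \<longleftrightarrow> (\<exists>c u. norm u = 1 \<and> g = line_reflection c u)"

definition glide_reflection :: "(complex \<Rightarrow> complex) \<Rightarrow> bool" where
  "glide_reflection g \<longleftrightarrow>
     (\<exists>c u t. norm u = 1 \<and> t \<noteq> 0 \<and> g = (\<lambda>z. line_reflection c u z + of_real t * u))"

definition type_p4 :: "(complex \<Rightarrow> complex) set \<Rightarrow> bool" where
  "type_p4 H \<longleftrightarrow>
     (\<exists>g\<in>H. quarter_turn g) \<and>
     (\<exists>a b. a \<noteq> b \<and> independent {a, b} \<and> (\<lambda>z. z + a) \<in> H \<and> (\<lambda>z. z + b) \<in> H) \<and>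
     \<not> (\<exists>g\<in>H. reflection g \<or> glide_reflection g)"

definition rotational_symmetry :: "prefabric \<Rightarrow> bool" where
  "rotational_symmetry D \<longleftrightarrow> type_p4 (planar_group D)"

end

theory Submission
  imports Defs
begin

text \<open>Identify each cell with a Gaussian integer. Every element of the planar group either preserves
  all colours of the design or exchanges them, and a translation keeps its effect on the colours when
  it is conjugated by another symmetry. A quarter-turn therefore makes the set \<open>L\<close> of the
  colour-preserving translations an ideal of the Gaussian integers, say generated by
  \<open>g (a + b i)\<close> with \<open>a\<close> and \<open>b\<close> coprime. The order is the least positive integer in \<open>L\<close>, which is
  \<open>g (a\<^sup>2 + b\<^sup>2)\<close>.

  Necessity. Without reflections and glide-reflections, a warp can be moved to any other warp only
  by translations and half-turns. Transitivity on the warps forces a translation by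
  \<open>2 + y i\<close>, possibly colour-exchanging (\<open>isonemal_imp_short_translation\<close>). Its image
  \<open>-y + 2 i\<close> under the quarter-turn has the same effect on the colours, so that their sum
  \<open>(2 - y) + (2 + y) i\<close> lies in \<open>L\<close>. Hence \<open>g\<close> divides \<open>4\<close>, and \<open>g = 4\<close> excludes an even \<open>a\<^sup>2 + b\<^sup>2\<close>.
  As \<open>a\<^sup>2 + b\<^sup>2\<close> is an odd sum \<open>f\<close> of two coprime squares or twice such a sum, the order is \<open>f\<close>,
  \<open>2 f\<close> or \<open>4 f\<close> (\<open>order_of_gaussian_ideal\<close>).

  Sufficiency. If \<open>f\<close> is an odd sum of two coprime squares, then \<open>-1\<close> is a square \<open>c\<^sup>2\<close> modulo both
  \<open>f\<close> and \<open>2 f\<close>. The cells with \<open>i \<equiv> c j\<close> modulo \<open>m\<close>, for \<open>m = f\<close> or \<open>m = 2 f\<close>, form a square satin of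
  order \<open>m\<close>: its translations are an ideal because \<open>c\<^sup>2 \<equiv> -1\<close>. Replacing each cell of the satin of
  order \<open>2 f\<close> by a block of two by two cells doubles the order. Isonemality survives, since half-turns
  about the centres of the blocks exchange the two warps through a block. A reflection or
  glide-reflection would conjugate the translation by \<open>c + i\<close> to one by \<open>c - i\<close> or \<open>1 + c i\<close>, up to
  sign and block size, and then \<open>m\<close> would divide \<open>2\<close>.\<close>

section \<open>Isometries of the tessellation\<close>

text \<open>The eight symmetries of the square, each followed by a translation. Coordinates are taken from
  the centre of a cell rather than from a corner, because then the induced maps of the column and
  row numbers are \<open>i \<mapsto> e * i + p\<close> and \<open>j \<mapsto> d * j + q\<close>, after an exchange of
  \<open>i\<close> and \<open>j\<close> when \<open>sw\<close> holds.\<close>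

definition grid_map :: "bool \<Rightarrow> int \<Rightarrow> int \<Rightarrow> int \<Rightarrow> int \<Rightarrow> complex \<Rightarrow> complex" where
  "grid_map sw e d p q z =
     Complex (of_int e * ((if sw then Im z else Re z) - 1/2) + of_int p + 1/2)
             (of_int d * ((if sw then Re z else Im z) - 1/2) + of_int q + 1/2)"

lemma mem_cell:
  "z \<in> cell i j \<longleftrightarrow> of_int i \<le> Re z \<and> Re z \<le> of_int i + 1 \<and> of_int j \<le> Im z \<and> Im z \<le> of_int j + 1"
  by (simp add: cell_def)

lemma mem_warp: "z \<in> warp i \<longleftrightarrow> of_int i \<le> Re z \<and> Re z \<le> of_int i + 1"
proof -
  have "\<exists>x. of_int x \<le> Im z \<and> Im z \<le> of_int x + 1"
    by (rule exI[of _ "\<lfloor>Im z\<rfloor>"]) linarith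
  then show ?thesis unfolding warp_def by (auto simp: mem_cell)
qed

lemma mem_weft: "z \<in> weft j \<longleftrightarrow> of_int j \<le> Im z \<and> Im z \<le> of_int j + 1"
proof -
  have "\<exists>x. of_int x \<le> Re z \<and> Re z \<le> of_int x + 1"
    by (rule exI[of _ "\<lfloor>Re z\<rfloor>"]) linarith
  then show ?thesis unfolding weft_def by (auto simp: mem_cell)
qed

lemma cell_eq_iff: "cell i j = cell k l \<longleftrightarrow> i = k \<and> j = l"
proof
  assume eq: "cell i j = cell k l"
  have "Complex (of_int i) (of_int j) \<in> cell i j" "Complex (of_int k) (of_int l) \<in> cell k l"
    by (auto simp: mem_cell)
  then have "Complex (of_int i) (of_int j) \<in> cell k l" "Complex (of_int k) (of_int l) \<in> cell i j"
    using eq by auto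
  then show "i = k \<and> j = l" by (auto simp: mem_cell)
qed auto

lemma warp_eq_iff: "warp i = warp k \<longleftrightarrow> i = k"
proof
  assume eq: "warp i = warp k"
  have "Complex (of_int i) 0 \<in> warp i" "Complex (of_int k) 0 \<in> warp k"
    by (auto simp: mem_warp)
  then have "Complex (of_int i) 0 \<in> warp k" "Complex (of_int k) 0 \<in> warp i"
    using eq by auto
  then show "i = k" by (auto simp: mem_warp)
qed auto

lemma weft_eq_iff: "weft i = weft k \<longleftrightarrow> i = k"
proof
  assume eq: "weft i = weft k"
  have "Complex 0 (of_int i) \<in> weft i" "Complex 0 (of_int k) \<in> weft k"
    by (auto simp: mem_weft)
  then have "Complex 0 (of_int i) \<in> weft k" "Complex 0 (of_int k) \<in> weft i"
    using eq by auto
  then show "i = k" by (auto simp: mem_weft)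
qed auto

lemma warp_neq_weft: "warp i \<noteq> weft j" "weft j \<noteq> warp i"
proof -
  have "Complex (of_int i) (of_int j + 2) \<in> warp i" "Complex (of_int i) (of_int j + 2) \<notin> weft j"
    by (auto simp: mem_warp mem_weft)
  then show "warp i \<noteq> weft j" "weft j \<noteq> warp i" by auto
qed

lemma grid_map_surj:
  assumes "e \<in> {1, -1}" "d \<in> {1, -1}"
  shows "surj (grid_map sw e d p q)"
proof (rule surjI)
  fix w
  show "grid_map sw e d p q
     (Complex (if sw then of_int d * (Im w - of_int q - 1/2) + 1/2 else of_int e * (Re w - of_int p - 1/2) + 1/2)
              (if sw then of_int e * (Re w - of_int p - 1/2) + 1/2 else of_int d * (Im w - of_int q - 1/2) + 1/2)) = w"
  proof -
    have "e = 1 \<or> e = -1" "d = 1 \<or> d = -1" using assms by auto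
    then show ?thesis
      by (elim disjE; cases sw) (simp_all add: grid_map_def complex_eq_iff)
  qed
qed

lemma image_eq_if_surj:
  assumes "surj g" "\<And>z. g z \<in> B \<longleftrightarrow> z \<in> A"
  shows "g ` A = B"
proof -
  have "A = g -` B" using assms(2) by auto
  then show ?thesis using assms(1) by (simp add: surj_image_vimage_eq)
qed

lemma unit_interval_image:
  fixes x :: real and e i p :: int
  assumes "e \<in> {1, -1}"
  shows "of_int (e * i + p) \<le> of_int e * (x - 1/2) + of_int p + 1/2 \<and>
         of_int e * (x - 1/2) + of_int p + 1/2 \<le> of_int (e * i + p) + 1
         \<longleftrightarrow> of_int i \<le> x \<and> x \<le> of_int i + 1"
proof -
  have "e = 1 \<or> e = -1" using assms by auto
  then show ?thesis by (elim disjE; simp; linarith)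
qed

lemma grid_map_cell:
  assumes "e \<in> {1, -1}" "d \<in> {1, -1}"
  shows "grid_map sw e d p q ` cell i j =
         cell (e * (if sw then j else i) + p) (d * (if sw then i else j) + q)"
proof (rule image_eq_if_surj[OF grid_map_surj[OF assms]])
  fix z
  show "grid_map sw e d p q z \<in> cell (e * (if sw then j else i) + p) (d * (if sw then i else j) + q)
    \<longleftrightarrow> z \<in> cell i j"
    using unit_interval_image[OF assms(1), of "if sw then j else i" p "if sw then Im z else Re z"]
      unit_interval_image[OF assms(2), of "if sw then i else j" q "if sw then Re z else Im z"]
    by (cases sw) (simp_all only: grid_map_def mem_cell complex.sel if_True if_False, blast+)
qed

lemma grid_map_warp:
  assumes "e \<in> {1, -1}" "d \<in> {1, -1}"
  shows "grid_map sw e d p q ` warp i = (if sw then weft (d * i + q) else warp (e * i + p))"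
proof (rule image_eq_if_surj[OF grid_map_surj[OF assms]])
  fix z
  show "grid_map sw e d p q z \<in> (if sw then weft (d * i + q) else warp (e * i + p)) \<longleftrightarrow> z \<in> warp i"
    using unit_interval_image[OF assms(1), of i p "Re z"] unit_interval_image[OF assms(2), of i q "Re z"]
    by (simp only: grid_map_def mem_warp mem_weft complex.sel if_True if_False split: if_split) blast
qed

lemma grid_map_weft:
  assumes "e \<in> {1, -1}" "d \<in> {1, -1}"
  shows "grid_map sw e d p q ` weft j = (if sw then warp (e * j + p) else weft (d * j + q))"
proof (rule image_eq_if_surj[OF grid_map_surj[OF assms]])
  fix z
  show "grid_map sw e d p q z \<in> (if sw then warp (e * j + p) else weft (d * j + q)) \<longleftrightarrow> z \<in> weft j"
    using unit_interval_image[OF assms(1), of j p "Im z"] unit_interval_image[OF assms(2), of j q "Im z"]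
    by (simp only: grid_map_def mem_warp mem_weft complex.sel if_True if_False split: if_split) blast
qed

lemma tessellation_isometry_grid_map:
  assumes "e \<in> {1, -1}" "d \<in> {1, -1}"
  shows "tessellation_isometry (grid_map sw e d p q)"
proof -
  have "dist (grid_map sw e d p q z) (grid_map sw e d p q w) = dist z w" for z w
  proof -
    have "(Re (grid_map sw e d p q z - grid_map sw e d p q w))\<^sup>2 + (Im (grid_map sw e d p q z - grid_map sw e d p q w))\<^sup>2
        = (Re (z - w))\<^sup>2 + (Im (z - w))\<^sup>2"
    proof -
      have "e = 1 \<or> e = -1" "d = 1 \<or> d = -1" using assms by auto
      then show ?thesis
        by (elim disjE; cases sw) (simp_all add: grid_map_def power2_eq_square algebra_simps)
    qed
    then show ?thesis by (simp add: dist_norm cmod_def)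
  qed
  moreover have "(\<lambda>c. grid_map sw e d p q ` c) ` cells = cells"
  proof
    show "(\<lambda>c. grid_map sw e d p q ` c) ` cells \<subseteq> cells"
      unfolding cells_def using grid_map_cell[OF assms] by fastforce
    show "cells \<subseteq> (\<lambda>c. grid_map sw e d p q ` c) ` cells"
    proof
      fix C assume "C \<in> cells"
      then obtain k l where C: "C = cell k l" unfolding cells_def by auto
      have "grid_map sw e d p q ` cell (if sw then d * (l - q) else e * (k - p)) (if sw then e * (k - p) else d * (l - q)) = C"
        unfolding grid_map_cell[OF assms] C using assms by auto
      then show "C \<in> (\<lambda>c. grid_map sw e d p q ` c) ` cells"
        unfolding cells_def by blast
    qed
  qed
  ultimately show ?thesis by (simp add: tessellation_isometry_def)
qed

text \<open>A unit square has diameter \<open>sqrt 2\<close>, attained only at the ends of its diagonals. This lets a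
  mere isometry that permutes the cells be recognised as a map of lattice points.\<close>

lemma diagonal_of_cell:
  assumes z: "z \<in> cell k l" and w: "w \<in> cell k l" and dist: "dist z w = sqrt 2"
  shows "Re z \<in> \<int> \<and> Im z \<in> \<int>"
proof -
  have "(norm (z - w))\<^sup>2 = 2" using dist by (simp add: dist_norm)
  then have sum: "(Re z - Re w)\<^sup>2 + (Im z - Im w)\<^sup>2 = 2" by (simp add: cmod_power2)
  have "\<bar>Re z - Re w\<bar> \<le> 1" "\<bar>Im z - Im w\<bar> \<le> 1" using z w unfolding mem_cell by linarith+
  then have "(Re z - Re w)\<^sup>2 \<le> 1" "(Im z - Im w)\<^sup>2 \<le> 1"
    by (simp_all add: abs_square_le_1)
  then have "(Re z - Re w)\<^sup>2 = 1" "(Im z - Im w)\<^sup>2 = 1" using sum by linarith+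
  then have "Re z - Re w = 1 \<or> Re z - Re w = -1" "Im z - Im w = 1 \<or> Im z - Im w = -1"
    by (simp_all add: power2_eq_1_iff)
  then have "Re z = of_int k \<or> Re z = of_int (k + 1)" "Im z = of_int l \<or> Im z = of_int (l + 1)"
    using z w unfolding mem_cell by auto
  then show ?thesis by (metis Ints_of_int)
qed

text \<open>Corners of a cell go to lattice points. Since an isometry is affine, it is determined by the
  images of \<open>0\<close>, \<open>1\<close> and \<open>i\<close>, which are thus integral; the integral vectors of length one are
  the four units.\<close>

lemma tessellation_isometry_imp_grid_map:
  assumes "tessellation_isometry g"
  obtains sw e d p q where "e \<in> {1, -1}" "d \<in> {1, -1}" "g = grid_map sw e d p q"
proof -
  have iso: "dist (g z) (g w) = dist z w" for z w
    using assms unfolding tessellation_isometry_def by blast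
  have "cell 0 0 \<in> cells" unfolding cells_def by blast
  then have "g ` cell 0 0 \<in> cells" using assms unfolding tessellation_isometry_def by blast
  then obtain k l where kl: "g ` cell 0 0 = cell k l" unfolding cells_def by blast
  have corner: "Re (g z) \<in> \<int> \<and> Im (g z) \<in> \<int>"
    if "z \<in> cell 0 0" "w \<in> cell 0 0" "dist z w = sqrt 2" for z w
  proof (rule diagonal_of_cell)
    show "g z \<in> cell k l" "g w \<in> cell k l" using that kl by auto
    show "dist (g z) (g w) = sqrt 2" using that iso by simp
  qed
  have c0: "Re (g 0) \<in> \<int> \<and> Im (g 0) \<in> \<int>"
    by (rule corner[of _ "1 + \<i>"]) (auto simp: mem_cell dist_norm cmod_def)
  have c1: "Re (g 1) \<in> \<int> \<and> Im (g 1) \<in> \<int>"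
    by (rule corner[of _ "\<i>"]) (auto simp: mem_cell dist_norm cmod_def)
  have ci: "Re (g \<i>) \<in> \<int> \<and> Im (g \<i>) \<in> \<int>"
    by (rule corner[of _ "1"]) (auto simp: mem_cell dist_norm cmod_def)
  define h where "h z = g z - g 0" for z
  have "orthogonal_transformation h"
    unfolding orthogonal_transformation_isometry h_def using iso by (simp add: dist_norm)
  then have lin: "linear h" by (simp add: orthogonal_transformation_def)
  have h: "h z = of_real (Re z) * h 1 + of_real (Im z) * h \<i>" for z
  proof -
    have "z = Re z *\<^sub>R 1 + Im z *\<^sub>R \<i>" by (simp add: complex_eq_iff)
    then have "h z = h (Re z *\<^sub>R 1 + Im z *\<^sub>R \<i>)" by simp
    also have "\<dots> = of_real (Re z) * h 1 + of_real (Im z) * h \<i>"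
      unfolding linear_add[OF lin] linear_scale[OF lin] by (simp add: scaleR_conv_of_real)
    finally show ?thesis .
  qed
  obtain x0 y0 a b a' b' where
    g0: "g 0 = Complex (of_int x0) (of_int y0)" and
    h1: "h 1 = Complex (of_int a) (of_int b)" and
    hi: "h \<i> = Complex (of_int a') (of_int b')"
  proof -
    have "Re (h 1) \<in> \<int>" "Im (h 1) \<in> \<int>" "Re (h \<i>) \<in> \<int>" "Im (h \<i>) \<in> \<int>"
      using c0 c1 ci by (auto simp: h_def)
    then show ?thesis using c0 that unfolding complex_eq_iff complex.sel by (metis Ints_cases)
  qed
  have "norm (h 1) = 1" "norm (h \<i>) = 1" "(norm (h 1 - h \<i>))\<^sup>2 = 2"
    using iso[of 1 0] iso[of \<i> 0] iso[of 1 \<i>] by (simp_all add: h_def dist_norm cmod_def)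
  then have "(of_int (a\<^sup>2 + b\<^sup>2) :: real) = 1" "(of_int (a'\<^sup>2 + b'\<^sup>2) :: real) = 1"
    "(of_int ((a - a')\<^sup>2 + (b - b')\<^sup>2) :: real) = 2"
    by (auto simp: h1 hi cmod_def)
  then have sq: "a\<^sup>2 + b\<^sup>2 = 1" "a'\<^sup>2 + b'\<^sup>2 = 1" "(a - a')\<^sup>2 + (b - b')\<^sup>2 = 2"
    by linarith+
  then have orth: "a * a' + b * b' = 0" by (simp add: power2_eq_square algebra_simps)
  have units: "x \<in> {1, -1} \<and> y = 0 \<or> x = 0 \<and> y \<in> {1, -1}" if "x\<^sup>2 + y\<^sup>2 = 1" for x y :: int
  proof -
    have "0 \<le> x\<^sup>2" "0 \<le> y\<^sup>2" by simp_all
    then have "x\<^sup>2 \<le> 1" "y\<^sup>2 \<le> 1" using that by linarith+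
    then have "\<bar>x\<bar> \<le> 1" "\<bar>y\<bar> \<le> 1" by (simp_all only: abs_square_le_1)
    then have "x \<in> {-1, 0, 1}" "y \<in> {-1, 0, 1}" by auto
    then show ?thesis using that by auto
  qed
  have gz: "g z = Complex (of_int x0 + Re z * of_int a + Im z * of_int a') (of_int y0 + Re z * of_int b + Im z * of_int b')"
    for z
    using h[of z] g0 h1 hi by (simp add: h_def complex_eq_iff)
  from units[OF sq(1)] show thesis
  proof
    assume A: "a \<in> {1, -1} \<and> b = 0"
    then have B: "a' = 0 \<and> b' \<in> {1, -1}" using units[OF sq(2)] orth by auto
    have "g = grid_map False a b' (x0 + (a - 1) div 2) (y0 + (b' - 1) div 2)"
      using A B by (auto simp: fun_eq_iff gz grid_map_def)
    then show thesis using that A B by blast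
  next
    assume A: "a = 0 \<and> b \<in> {1, -1}"
    then have B: "b' = 0 \<and> a' \<in> {1, -1}" using units[OF sq(2)] orth by auto
    have "g = grid_map True a' b (x0 + (a' - 1) div 2) (y0 + (b - 1) div 2)"
      using A B by (auto simp: fun_eq_iff gz grid_map_def)
    then show thesis using that A B by blast
  qed
qed

section \<open>Symmetries of a design in terms of colours\<close>

text \<open>The flag \<open>s\<close> records whether the colours are exchanged. It differs from the side
  component of a symmetry when warps go to wefts: a quarter-turn that preserves the sides of the
  plane exchanges the colours.\<close>

definition design_symmetry :: "prefabric \<Rightarrow> bool \<Rightarrow> int \<Rightarrow> int \<Rightarrow> int \<Rightarrow> int \<Rightarrow> bool \<Rightarrow> bool" where
  "design_symmetry D sw e d p q s \<longleftrightarrow>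
     (\<forall>i j. D (e * (if sw then j else i) + p) (d * (if sw then i else j) + q) \<longleftrightarrow> D i j \<noteq> s)"

lemma grid_map_symmetry_iff:
  assumes "e \<in> {1, -1}" "d \<in> {1, -1}"
  shows "(grid_map sw e d p q, \<epsilon>) \<in> symmetries D \<longleftrightarrow> design_symmetry D sw e d p q (sw \<noteq> (\<epsilon> = Reverse))"
proof -
  have all_eq: "(\<forall>k l. x = k \<and> y = l \<longrightarrow> P k l) \<longleftrightarrow> P x y" for x y :: int and P
    by blast
  have "(grid_map sw e d p q, \<epsilon>) \<in> symmetries D \<longleftrightarrow>
    (\<forall>i j. grid_map sw e d p q ` uppermost D i j = (case \<epsilon> of
       Preserve \<Rightarrow> uppermost D (e * (if sw then j else i) + p) (d * (if sw then i else j) + q)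
     | Reverse \<Rightarrow> lowermost D (e * (if sw then j else i) + p) (d * (if sw then i else j) + q)))"
    unfolding symmetries_def mem_Collect_eq case_prod_conv grid_map_cell[OF assms] cell_eq_iff all_eq
    using tessellation_isometry_grid_map[OF assms] by blast
  also have "\<dots> \<longleftrightarrow> design_symmetry D sw e d p q (sw \<noteq> (\<epsilon> = Reverse))"
  proof -
    have "grid_map sw e d p q ` uppermost D i j = (case \<epsilon> of
       Preserve \<Rightarrow> uppermost D (e * (if sw then j else i) + p) (d * (if sw then i else j) + q)
     | Reverse \<Rightarrow> lowermost D (e * (if sw then j else i) + p) (d * (if sw then i else j) + q))
     \<longleftrightarrow> (D (e * (if sw then j else i) + p) (d * (if sw then i else j) + q) \<longleftrightarrow> D i j \<noteq> (sw \<noteq> (\<epsilon> = Reverse)))"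
      for i j
      unfolding uppermost_def lowermost_def if_distrib[of "image (grid_map sw e d p q)"]
        grid_map_warp[OF assms] grid_map_weft[OF assms]
      by (cases \<epsilon>; cases sw) (simp_all add: warp_eq_iff weft_eq_iff warp_neq_weft)
    then show ?thesis unfolding design_symmetry_def by simp
  qed
  finally show ?thesis .
qed

lemma grid_map_planar_group_iff:
  assumes "e \<in> {1, -1}" "d \<in> {1, -1}"
  shows "grid_map sw e d p q \<in> planar_group D \<longleftrightarrow> (\<exists>s. design_symmetry D sw e d p q s)"
proof -
  have "grid_map sw e d p q \<in> planar_group D \<longleftrightarrow> (\<exists>\<epsilon>. (grid_map sw e d p q, \<epsilon>) \<in> symmetries D)"
    unfolding planar_group_def by force
  also have "\<dots> \<longleftrightarrow> (\<exists>s. design_symmetry D sw e d p q s)"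
  proof
    assume "\<exists>s. design_symmetry D sw e d p q s"
    then obtain s where s: "design_symmetry D sw e d p q s" by blast
    show "\<exists>\<epsilon>. (grid_map sw e d p q, \<epsilon>) \<in> symmetries D"
      unfolding grid_map_symmetry_iff[OF assms] using s
      by (intro exI[of _ "if s = sw then Preserve else Reverse"]) (cases s; cases sw; simp)
  qed (auto simp: grid_map_symmetry_iff[OF assms])
  finally show ?thesis .
qed

lemma planar_group_imp_grid_map:
  assumes "g \<in> planar_group D"
  obtains sw e d p q s where "e \<in> {1, -1}" "d \<in> {1, -1}" "g = grid_map sw e d p q"
    "design_symmetry D sw e d p q s"
proof -
  have "tessellation_isometry g" using assms by (auto simp: planar_group_def symmetries_def)
  then obtain sw e d p q where "e \<in> {1, -1}" "d \<in> {1, -1}" "g = grid_map sw e d p q"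
    by (rule tessellation_isometry_imp_grid_map)
  then show thesis using that assms grid_map_planar_group_iff by metis
qed

text \<open>The motion conjugates the translation, and conjugation cancels its effect on the colours.\<close>

lemma design_symmetry_conjugate_translation:
  assumes g: "design_symmetry D sw e d p q s" and units: "e \<in> {1, -1}" "d \<in> {1, -1}"
    and t: "design_symmetry D False 1 1 x y r"
  shows "design_symmetry D False 1 1 (e * (if sw then y else x)) (d * (if sw then x else y)) r"
proof -
  have ee: "e * e = 1" "d * d = 1" using units by auto
  have t': "D (i + x) (j + y) \<longleftrightarrow> D i j \<noteq> r" for i j using t by (simp add: design_symmetry_def)
  have "D (i + e * (if sw then y else x)) (j + d * (if sw then x else y)) \<longleftrightarrow> D i j \<noteq> r" for i j
  proof (cases sw)
    case True
    then have g': "D (e * b + p) (d * a + q) \<longleftrightarrow> D a b \<noteq> s" for a b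
      using g by (simp add: design_symmetry_def)
    define a b where "a = d * (j - q)" and "b = e * (i - p)"
    have ij: "i = e * b + p" "j = d * a + q"
      using ee by (simp_all add: a_def b_def mult.assoc[symmetric])
    have "D (i + e * y) (j + d * x) = D (e * (b + y) + p) (d * (a + x) + q)"
      unfolding ij by (simp add: algebra_simps)
    also have "\<dots> \<longleftrightarrow> (D a b \<noteq> r) \<noteq> s" unfolding g' t' ..
    also have "\<dots> \<longleftrightarrow> D i j \<noteq> r" unfolding ij g' by blast
    finally show ?thesis using True by simp
  next
    case False
    then have g': "D (e * a + p) (d * b + q) \<longleftrightarrow> D a b \<noteq> s" for a b
      using g by (simp add: design_symmetry_def)
    define a b where "a = e * (i - p)" and "b = d * (j - q)"
    have ij: "i = e * a + p" "j = d * b + q"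
      using ee by (simp_all add: a_def b_def mult.assoc[symmetric])
    have "D (i + e * x) (j + d * y) = D (e * (a + x) + p) (d * (b + y) + q)"
      unfolding ij by (simp add: algebra_simps)
    also have "\<dots> \<longleftrightarrow> (D a b \<noteq> r) \<noteq> s" unfolding g' t' ..
    also have "\<dots> \<longleftrightarrow> D i j \<noteq> r" unfolding ij g' by blast
    finally show ?thesis using False by simp
  qed
  then show ?thesis by (simp add: design_symmetry_def)
qed

text \<open>The linear part has determinant \<open>- (e * d)\<close> if it exchanges the axes, and \<open>e * d\<close> otherwise.\<close>

definition orientation_reversing :: "bool \<Rightarrow> int \<Rightarrow> int \<Rightarrow> bool" where
  "orientation_reversing sw e d \<longleftrightarrow> (if sw then d = e else d = - e)"

text \<open>The direction \<open>v\<close> of the axis is a square root of \<open>u\<close>. The component of \<open>b\<close> along \<open>v\<close> is the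
  glide, and half of the component perpendicular to \<open>v\<close> is a point of the axis.\<close>

lemma conj_affine_is_reflection:
  assumes u: "norm u = 1" and g: "\<And>z. g z = u * cnj z + b"
  shows "reflection g \<or> glide_reflection g"
proof -
  define v where "v = csqrt u"
  have v2: "v\<^sup>2 = u" by (simp add: v_def)
  have nv: "norm v = 1" using u by (simp add: v_def)
  then have vv: "v * cnj v = 1" by (simp add: complex_norm_square[symmetric])
  define t where "t = Re (b * cnj v)"
  define c where "c = (b - of_real t * v) / 2"
  have t: "2 * of_real t = b * cnj v + cnj b * v"
    unfolding t_def using complex_add_cnj[of "b * cnj v"] by simp
  have "c - v\<^sup>2 * cnj c + of_real t * v = b"
  proof -
    have "2 * (c - v\<^sup>2 * cnj c + of_real t * v) =
       b - v\<^sup>2 * cnj b + (2 * of_real t) * v / 2 + (2 * of_real t) * v * (v * cnj v) / 2"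
      by (simp add: c_def power2_eq_square field_simps)
    also have "\<dots> = b - v\<^sup>2 * cnj b + (b * cnj v + cnj b * v) * v"
      unfolding vv t by simp
    also have "\<dots> = b + b * (v * cnj v)" by (simp add: power2_eq_square algebra_simps)
    also have "\<dots> = 2 * b" unfolding vv by simp
    finally show ?thesis by (metis mult_cancel_left zero_neq_numeral)
  qed
  then have "g z = line_reflection c v z + of_real t * v" for z
    unfolding g line_reflection_def v2 by (simp add: algebra_simps)
  then have g_eq: "g = (\<lambda>z. line_reflection c v z + of_real t * v)" by blast
  show ?thesis
  proof (cases "t = 0")
    case True
    then have "g = line_reflection c v" using g_eq by simp
    then show ?thesis using nv unfolding reflection_def by blast
  next
    case False
    then show ?thesis using nv g_eq unfolding glide_reflection_def by blast
  qed
qed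

lemma orientation_reversing_imp_reflection:
  assumes "e \<in> {1, -1}" "d \<in> {1, -1}" "orientation_reversing sw e d"
  shows "reflection (grid_map sw e d p q) \<or> glide_reflection (grid_map sw e d p q)"
proof (rule conj_affine_is_reflection)
  show "norm (if sw then of_int e * \<i> else of_int e :: complex) = 1"
    using assms by (auto simp: norm_mult)
  show "grid_map sw e d p q z = (if sw then of_int e * \<i> else of_int e) * cnj z + grid_map sw e d p q 0" for z
    using assms by (auto simp: grid_map_def orientation_reversing_def complex_eq_iff)
qed

lemma reflection_imp_orientation_reversing:
  assumes units: "e \<in> {1, -1}" "d \<in> {1, -1}"
    and refl: "reflection (grid_map sw e d p q) \<or> glide_reflection (grid_map sw e d p q)"
  shows "orientation_reversing sw e d"
proof -
  let ?g = "grid_map sw e d p q"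
  obtain c u b where g: "\<And>z. ?g z = line_reflection c u z + b"
    using refl unfolding reflection_def glide_reflection_def fun_eq_iff
    by (metis add.right_neutral)
  \<comment> \<open>An orientation-preserving motion would have \<open>\<i>\<close> in place of \<open>-\<i>\<close> here.\<close>
  have "?g \<i> - ?g 0 = - \<i> * (?g 1 - ?g 0)"
    unfolding g line_reflection_def by (simp add: algebra_simps)
  then show ?thesis using units
    by (cases sw) (auto simp: grid_map_def orientation_reversing_def complex_eq_iff)
qed

section \<open>Ideals of the Gaussian integers\<close>

lemma nearest_multiple:
  fixes x m :: int
  assumes "m > 0"
  shows "\<exists>k. \<bar>2 * (x - k * m)\<bar> \<le> m"
proof -
  define k where "k = (2 * x + m) div (2 * m)"
  have "2 * x + m = k * (2 * m) + (2 * x + m) mod (2 * m)"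
    unfolding k_def by (simp only: div_mult_mod_eq)
  moreover have "0 \<le> (2 * x + m) mod (2 * m)" "(2 * x + m) mod (2 * m) < 2 * m"
    using assms by simp_all
  ultimately have "\<bar>2 * (x - k * m)\<bar> \<le> m" by (simp add: algebra_simps abs_le_iff)
  then show ?thesis by blast
qed

text \<open>Euclidean division: an element of least norm generates, because rounding both coordinates of a
  quotient leaves a remainder of at most half that norm.\<close>

lemma gaussian_ideal_principal:
  fixes L :: "(int \<times> int) set"
  assumes diff: "\<And>x y x' y'. (x, y) \<in> L \<Longrightarrow> (x', y') \<in> L \<Longrightarrow> (x - x', y - y') \<in> L"
    and mult: "\<And>x y k l. (x, y) \<in> L \<Longrightarrow> (k * x - l * y, k * y + l * x) \<in> L"
    and nz: "(x0, y0) \<in> L" "(x0, y0) \<noteq> (0, 0)"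
  obtains a b where "(a, b) \<in> L" "(a, b) \<noteq> (0, 0)"
    "\<And>x y. (x, y) \<in> L \<Longrightarrow> \<exists>k l. x = k * a - l * b \<and> y = k * b + l * a"
proof -
  define nrm :: "int \<times> int \<Rightarrow> nat" where "nrm v = nat ((fst v)\<^sup>2 + (snd v)\<^sup>2)" for v
  obtain v where v: "v \<in> L \<and> v \<noteq> (0, 0)" and
    min: "\<And>w. w \<in> L \<and> w \<noteq> (0, 0) \<Longrightarrow> nrm v \<le> nrm w"
    using ex_has_least_nat[of "\<lambda>w. w \<in> L \<and> w \<noteq> (0, 0)" "(x0, y0)" nrm] nz by blast
  obtain a b where ab: "v = (a, b)" by force
  define n where "n = a\<^sup>2 + b\<^sup>2"
  have n: "n > 0" using v ab unfolding n_def by (auto simp: sum_power2_gt_zero_iff)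
  have "\<exists>k l. x = k * a - l * b \<and> y = k * b + l * a" if xy: "(x, y) \<in> L" for x y
  proof -
    obtain k where k: "\<bar>2 * ((x * a + y * b) - k * n)\<bar> \<le> n" using nearest_multiple[OF n] by blast
    obtain l where l: "\<bar>2 * ((y * a - x * b) - l * n)\<bar> \<le> n" using nearest_multiple[OF n] by blast
    define r s where "r = x - (k * a - l * b)" and "s = y - (k * b + l * a)"
    have rs: "(r, s) \<in> L" unfolding r_def s_def using diff xy mult v ab by simp
    \<comment> \<open>Multiplying the remainder by the conjugate of \<open>a + b i\<close> gives the rounding errors.\<close>
    have "4 * (r\<^sup>2 + s\<^sup>2) * n = (2 * ((x * a + y * b) - k * n))\<^sup>2 + (2 * ((y * a - x * b) - l * n))\<^sup>2"
      unfolding r_def s_def n_def by (simp add: power2_eq_square algebra_simps)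
    also have "\<dots> \<le> n\<^sup>2 + n\<^sup>2"
      using k l n by (intro add_mono) (simp_all add: abs_le_square_iff[symmetric])
    finally have "(4 * (r\<^sup>2 + s\<^sup>2)) * n \<le> (2 * n) * n" by (simp add: power2_eq_square)
    then have "4 * (r\<^sup>2 + s\<^sup>2) \<le> 2 * n" using n by simp
    then have "nrm (r, s) < nrm v" using n unfolding nrm_def ab n_def by simp
    then have "r = 0 \<and> s = 0" using min rs by (metis leD prod.inject)
    then have "x = k * a - l * b \<and> y = k * b + l * a" by (simp add: r_def s_def)
    then show ?thesis by blast
  qed
  then show thesis using that v ab by blast
qed

section \<open>The order of an isonemal design with quarter-turns\<close>

text \<open>The numbers \<open>v\<close> and \<open>u\<close> are the coordinates of \<open>(a + b i) / (1 - i)\<close>. Coprime numbers of equal parity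
  are odd, and \<open>u + v = a\<close> makes the new norm odd.\<close>

lemma coprime_sum_squares_div_2:
  fixes a b :: int
  assumes cop: "coprime a b" and ev: "even (a\<^sup>2 + b\<^sup>2)"
  obtains u v where "coprime u v" "a\<^sup>2 + b\<^sup>2 = 2 * (u\<^sup>2 + v\<^sup>2)" "odd (u\<^sup>2 + v\<^sup>2)"
proof -
  have par: "even a \<longleftrightarrow> even b" using ev by simp
  then have "odd a" using cop by (metis coprime_common_divisor odd_one)
  define u v where "u = (a + b) div 2" and "v = (a - b) div 2"
  have "2 * u = a + b" "2 * v = a - b" using par unfolding u_def v_def by simp_all
  then have uv: "a = u + v" "b = u - v" by linarith+
  have "coprime u v"
  proof (rule coprimeI)
    fix c assume "c dvd u" "c dvd v"
    then have "c dvd a" "c dvd b" unfolding uv by auto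
    with cop show "is_unit c" by (rule coprime_common_divisor)
  qed
  moreover have "a\<^sup>2 + b\<^sup>2 = 2 * (u\<^sup>2 + v\<^sup>2)" unfolding uv by (simp add: power2_eq_square algebra_simps)
  moreover have "odd (u\<^sup>2 + v\<^sup>2)" using \<open>odd a\<close> unfolding uv by auto
  ultimately show thesis using that by blast
qed

text \<open>The arithmetic of the necessity. The ideal is generated by \<open>g (a + b i)\<close> with \<open>a\<close> and \<open>b\<close> coprime,
  so a positive integer lies in it exactly when it is a multiple of \<open>g (a\<^sup>2 + b\<^sup>2)\<close>. The given element is
  \<open>(1 + i) (2 + y i)\<close>; the sum of its coordinates is \<open>4\<close>, which bounds the power of two.\<close>

lemma order_of_gaussian_ideal:
  fixes L :: "(int \<times> int) set"
  assumes diff: "\<And>x y x' y'. (x, y) \<in> L \<Longrightarrow> (x', y') \<in> L \<Longrightarrow> (x - x', y - y') \<in> L"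
    and mult: "\<And>x y k l. (x, y) \<in> L \<Longrightarrow> (k * x - l * y, k * y + l * x) \<in> L"
    and n: "n > 0" "(n, 0) \<in> L" "\<And>m. m > 0 \<Longrightarrow> (m, 0) \<in> L \<Longrightarrow> n \<le> m"
    and w: "(2 - y, 2 + y) \<in> L"
  shows "\<exists>u v k. coprime u v \<and> odd (u\<^sup>2 + v\<^sup>2) \<and> k \<in> {0, 1, 2::nat} \<and> n = (u\<^sup>2 + v\<^sup>2) * 2 ^ k"
proof -
  have nz: "(n, 0) \<noteq> (0, 0)" using n(1) by simp
  obtain \<alpha> \<beta> where \<alpha>\<beta>: "(\<alpha>, \<beta>) \<in> L" "(\<alpha>, \<beta>) \<noteq> (0, 0)" and
    gen: "\<And>x y. (x, y) \<in> L \<Longrightarrow> \<exists>k l. x = k * \<alpha> - l * \<beta> \<and> y = k * \<beta> + l * \<alpha>"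
  proof (rule gaussian_ideal_principal[of L n 0])
    show "(n, 0) \<in> L" "(n, 0) \<noteq> (0, 0)" by (fact n(2) nz)+
    show "(x - x', y - y') \<in> L" if "(x, y) \<in> L" "(x', y') \<in> L" for x y x' y'
      using that by (rule diff)
    show "(k * x - l * y, k * y + l * x) \<in> L" if "(x, y) \<in> L" for x y k l
      using that by (rule mult)
  qed (rule that)
  define g where "g = gcd \<alpha> \<beta>"
  have g: "g > 0" using \<alpha>\<beta>(2) unfolding g_def by auto
  obtain a b where ab: "\<alpha> = g * a" "\<beta> = g * b"
    unfolding g_def by (meson dvdE gcd_dvd1 gcd_dvd2)
  have "gcd \<alpha> \<beta> = g" by (simp only: g_def)
  then have "gcd (g * a) (g * b) = g" unfolding ab .
  then have "g * gcd a b = g" using gcd_mult_distrib_int[of g a b] g by (simp only: abs_of_pos)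
  then have cop: "coprime a b" using g by (simp add: coprime_iff_gcd_eq_1)
  define N where "N = a\<^sup>2 + b\<^sup>2"
  have ng: "n = g * N"
  proof -
    obtain k l where kl: "n = k * \<alpha> - l * \<beta>" "0 = k * \<beta> + l * \<alpha>" using gen[OF n(2)] by blast
    have "g * (k * b + l * a) = 0" using kl(2) unfolding ab by (simp add: algebra_simps)
    then have 0: "k * b = - (l * a)" using g by auto
    then have "a dvd k * b" by simp
    then have "a dvd k" using cop by (simp add: coprime_dvd_mult_left_iff)
    then obtain c where c: "k = a * c" by blast
    have "g * N dvd n"
    proof (cases "a = 0")
      case True
      then have "b\<^sup>2 = 1" using cop by (auto simp: power2_eq_1_iff)
      then show ?thesis unfolding kl(1) N_def ab using True \<open>b\<^sup>2 = 1\<close> by simp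
    next
      case False
      have "a * (l + b * c) = 0" using 0 unfolding c by (simp add: algebra_simps)
      then have "l = - (b * c)" using False by auto
      then have "n = (g * N) * c" unfolding kl(1) c ab N_def by (simp add: power2_eq_square algebra_simps)
      then show ?thesis by simp
    qed
    then have "g * N \<le> n" using n(1) by (simp add: zdvd_imp_le)
    have "(a * \<alpha> - (-b) * \<beta>, a * \<beta> + (-b) * \<alpha>) \<in> L" using mult \<alpha>\<beta>(1) by blast
    then have "(g * N, 0) \<in> L" unfolding ab N_def by (simp add: power2_eq_square algebra_simps)
    moreover have "g * N > 0"
    proof -
      have "N \<ge> 0" unfolding N_def by simp
      moreover have "N \<noteq> 0" using n(1) \<open>g * N dvd n\<close> by auto
      ultimately show ?thesis using g by simp
    qed
    ultimately show ?thesis using n(3) \<open>g * N \<le> n\<close> by force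
  qed
  obtain k l where kl: "2 - y = g * (k * a - l * b)" "2 + y = g * (k * b + l * a)"
    using gen[OF w] unfolding ab by (auto simp: algebra_simps)
  \<comment> \<open>If \<open>a\<close> and \<open>b\<close> are both odd, the factor beside \<open>g\<close> is even, so that \<open>g\<close> is at most \<open>2\<close>.\<close>
  have sum: "4 = g * (k * (a + b) + l * (a - b))"
    using kl by (simp add: algebra_simps)
  then have "g dvd 4" by (metis dvd_triv_left)
  have "g \<le> 4" using \<open>g dvd 4\<close> by (simp add: zdvd_imp_le)
  then have g_cases: "g = 1 \<or> g = 2 \<or> g = 4"
  proof -
    from g \<open>g \<le> 4\<close> consider "g = 1" | "g = 2" | "g = 3" | "g = 4" by linarith
    then show ?thesis using \<open>g dvd 4\<close> by cases auto
  qed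
  show ?thesis
  proof (cases "even N")
    case False
    have "\<exists>j\<in>{0, 1, 2::nat}. g = 2 ^ j" using g_cases by simp
    then obtain j :: nat where "j \<in> {0, 1, 2}" "g = 2 ^ j" by blast
    moreover from this have "n = (a\<^sup>2 + b\<^sup>2) * 2 ^ j" using ng unfolding N_def by simp
    ultimately show ?thesis using cop False unfolding N_def by blast
  next
    case True
    have "even (a + b)" "even (a - b)" using True unfolding N_def by auto
    then have "even (k * (a + b) + l * (a - b))" by simp
    then obtain t where "k * (a + b) + l * (a - b) = 2 * t" by (elim evenE)
    then have "4 = g * (2 * t)" using sum by (simp only:)
    have "g \<noteq> 4"
    proof
      assume "g = 4"
      with \<open>4 = g * (2 * t)\<close> have "2 * t = 1" by simp
      then show False by presburger
    qed
    then have "\<exists>j\<in>{0, 1, 2::nat}. g * 2 = 2 ^ j" using g_cases by auto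
    then obtain j :: nat where j: "j \<in> {0, 1, 2}" "g * 2 = 2 ^ j" by blast
    obtain u v where "coprime u v" "N = 2 * (u\<^sup>2 + v\<^sup>2)" "odd (u\<^sup>2 + v\<^sup>2)"
      using coprime_sum_squares_div_2 cop True unfolding N_def by blast
    moreover from this have "n = (u\<^sup>2 + v\<^sup>2) * 2 ^ j" using ng j(2)[symmetric] by simp
    ultimately show ?thesis using j(1) by blast
  qed
qed

text \<open>The parameter \<open>k\<close> is the number of the warp to which warp \<open>0\<close> goes. If warps \<open>1\<close> and \<open>2\<close> are both
  reached only by half-turns, the product of two of these is a translation by one column, and
  any translation by one column can be doubled.\<close>

lemma isonemal_imp_short_translation:
  assumes shifts: "\<And>k. \<exists>e d q s. e \<in> {1, -1} \<and> d \<in> {1, -1} \<and> \<not> orientation_reversing False e d \<and>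
      design_symmetry D False e d k q s"
  shows "\<exists>y s. design_symmetry D False 1 1 2 y s"
proof -
  have double: ?thesis if "design_symmetry D False 1 1 1 y s" for y s
  proof -
    have *: "D (i + 1) (j + y) \<longleftrightarrow> D i j \<noteq> s" for i j
      using that by (simp add: design_symmetry_def)
    have "D (i + 2) (j + 2 * y) \<longleftrightarrow> D i j" for i j
    proof -
      have "D (i + 2) (j + 2 * y) = D (i + 1 + 1) (j + y + y)" by (simp add: algebra_simps)
      also have "\<dots> \<longleftrightarrow> D i j" unfolding * by blast
      finally show ?thesis .
    qed
    then have "design_symmetry D False 1 1 2 (2 * y) False"
      by (simp add: design_symmetry_def)
    then show ?thesis by blast
  qed
  have alt: "\<exists>y s. design_symmetry D False 1 1 k y s \<or> design_symmetry D False (-1) (-1) k y s" for k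
    using shifts[of k] by (auto simp: orientation_reversing_def)
  obtain y1 s1 where 1: "design_symmetry D False 1 1 1 y1 s1 \<or> design_symmetry D False (-1) (-1) 1 y1 s1"
    using alt by blast
  obtain y2 s2 where 2: "design_symmetry D False 1 1 2 y2 s2 \<or> design_symmetry D False (-1) (-1) 2 y2 s2"
    using alt by blast
  show ?thesis
  proof (cases "design_symmetry D False 1 1 1 y1 s1 \<or> design_symmetry D False 1 1 2 y2 s2")
    case True
    then show ?thesis using double by blast
  next
    case False
    then have h: "D (1 - i) (y1 - j) \<longleftrightarrow> D i j \<noteq> s1" "D (2 - i) (y2 - j) \<longleftrightarrow> D i j \<noteq> s2" for i j
      using 1 2 by (auto simp: design_symmetry_def)
    have "D (i + 1) (j + (y2 - y1)) \<longleftrightarrow> D i j \<noteq> (s1 \<noteq> s2)" for i j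
      using h(1)[of i j] h(2)[of "1 - i" "y1 - j"] by (simp add: algebra_simps) blast
    then have "design_symmetry D False 1 1 1 (y2 - y1) (s1 \<noteq> s2)"
      by (simp add: design_symmetry_def)
    then show ?thesis by (rule double)
  qed
qed

text \<open>The colour-preserving translations form an ideal, multiplication by \<open>i\<close> being conjugation by the
  quarter-turn. The short translation itself may exchange the colours, but added to its image under
  the quarter-turn it preserves them.\<close>

lemma order_of_quarter_turn_design:
  assumes quarter: "design_symmetry D True e d p q s" "e \<in> {1, -1}" "d = - e"
    and short: "design_symmetry D False 1 1 2 y r"
    and order: "has_order D n"
  shows "\<exists>u v k. coprime u v \<and> odd (u\<^sup>2 + v\<^sup>2) \<and> k \<in> {0, 1, 2::nat} \<and> int n = (u\<^sup>2 + v\<^sup>2) * 2 ^ k"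
proof -
  define tr where "tr x y r = design_symmetry D False 1 1 x y r" for x y r
  have tr: "tr x y r \<longleftrightarrow> (\<forall>i j. D (i + x) (j + y) \<longleftrightarrow> D i j \<noteq> r)" for x y r
    by (simp add: tr_def design_symmetry_def)
  have trD: "D (i + x) (j + y) \<longleftrightarrow> D i j \<noteq> r" if "tr x y r" for x y r i j
    using that[unfolded tr, THEN spec, THEN spec] .
  have add: "tr (x + x') (y + y') (r \<noteq> r')" if "tr x y r" "tr x' y' r'" for x y r x' y' r'
  proof -
    have "D (i + x + x') (j + y + y') \<longleftrightarrow> D i j \<noteq> (r \<noteq> r')" for i j
      using trD[OF that(1), of i j] trD[OF that(2), of "i + x" "j + y"] by argo
    then show ?thesis unfolding tr by (simp add: add.assoc)
  qed
  have neg: "tr (- x) (- y) r" if "tr x y r" for x y r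
  proof -
    have "D (i + - x) (j + - y) \<longleftrightarrow> D i j \<noteq> r" for i j
      using trD[OF that, of "i - x" "j - y"] by auto
    then show ?thesis unfolding tr by blast
  qed
  have turn: "tr (- y) x r" if "tr x y r" for x y r
  proof -
    have "tr (e * y) (d * x) r"
      using design_symmetry_conjugate_translation[OF quarter(1,2) _ that[unfolded tr_def]] quarter
      unfolding tr_def by auto
    then show ?thesis using quarter(2,3) neg[of "e * y" "d * x"] by auto
  qed
  define L where "L = {(x, y). tr x y False}"
  have L: "(x, y) \<in> L \<longleftrightarrow> tr x y False" for x y by (simp add: L_def)
  have zero: "(0, 0) \<in> L" unfolding L tr by simp
  have Ladd: "(x + x', y + y') \<in> L" if "(x, y) \<in> L" "(x', y') \<in> L" for x y x' y'
    using add that unfolding L by fastforce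
  have Lneg: "(- x, - y) \<in> L" if "(x, y) \<in> L" for x y using neg that unfolding L by blast
  have Lturn: "(- y, x) \<in> L" if "(x, y) \<in> L" for x y using turn that unfolding L by blast
  have diff: "(x - x', y - y') \<in> L" if "(x, y) \<in> L" "(x', y') \<in> L" for x y x' y'
    using Ladd[OF that(1) Lneg[OF that(2)]] by simp
  have scale: "(k * x, k * y) \<in> L" if "(x, y) \<in> L" for x y and k :: int
  proof (induction k rule: int_induct[where k = 0])
    case base then show ?case using zero by simp
  next
    case (step1 i) then show ?case using Ladd[OF _ that] by (simp add: distrib_right)
  next
    case (step2 i) then show ?case using diff[OF _ that] by (simp add: left_diff_distrib)
  qed
  have mult: "(k * x - l * y, k * y + l * x) \<in> L" if "(x, y) \<in> L" for x y k l
    using Ladd[OF scale[OF that, of k] scale[OF Lturn[OF that], of l]] by simp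
  have period: "(int m, 0) \<in> L \<longleftrightarrow> repeats_every D m" for m
  proof
    assume "(int m, 0) \<in> L"
    moreover from this have "(0, int m) \<in> L" using Lturn by fastforce
    ultimately show "repeats_every D m" unfolding L tr repeats_every_def by simp
  qed (simp add: L tr repeats_every_def)
  have n: "n > 0" "repeats_every D n" "\<And>m. m > 0 \<Longrightarrow> repeats_every D m \<Longrightarrow> n \<le> m"
    using order unfolding has_order_def by auto
  have w: "(2 - y, 2 + y) \<in> L"
  proof -
    have "tr 2 y r" using short unfolding tr_def .
    from add[OF this turn[OF this]] show ?thesis unfolding L by (simp add: add.commute)
  qed
  have least: "int n \<le> m" if "m > 0" "(m, 0) \<in> L" for m
    using n(3)[of "nat m"] period[of "nat m"] that by auto
  show ?thesis
  proof (rule order_of_gaussian_ideal[of L "int n" y])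
    show "(x - x', y - y') \<in> L" if "(x, y) \<in> L" "(x', y') \<in> L" for x y x' y'
      using that by (rule diff)
    show "(k * x - l * y, k * y + l * x) \<in> L" if "(x, y) \<in> L" for x y k l
      using that by (rule mult)
    show "int n > 0" "(int n, 0) \<in> L" using n period by simp_all
    show "int n \<le> m" if "m > 0" "(m, 0) \<in> L" for m using that by (rule least)
    show "(2 - y, 2 + y) \<in> L" by (fact w)
  qed
qed

text \<open>Columns are mapped to columns only by motions without exchange of the axes, and the absence of
  reflections and glide-reflections leaves translations and half-turns among these.\<close>

lemma rotational_isonemal_order:
  assumes iso: "isonemal D" and rot: "rotational_symmetry D" and order: "has_order D n"
  shows "\<exists>u v k. coprime u v \<and> odd (u\<^sup>2 + v\<^sup>2) \<and> k \<in> {0, 1, 2::nat} \<and> int n = (u\<^sup>2 + v\<^sup>2) * 2 ^ k"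
proof -
  have p4: "\<exists>g\<in>planar_group D. quarter_turn g"
    "\<And>g. g \<in> planar_group D \<Longrightarrow> \<not> (reflection g \<or> glide_reflection g)"
    using rot unfolding rotational_symmetry_def type_p4_def by blast+
  have direct: "\<not> orientation_reversing sw e d"
    if "design_symmetry D sw e d p q s" "e \<in> {1, -1}" "d \<in> {1, -1}" for sw e d p q s
    using that p4(2) grid_map_planar_group_iff orientation_reversing_imp_reflection by metis
  obtain g where g: "g \<in> planar_group D" "quarter_turn g" using p4(1) by blast
  obtain sw e d p q s where units: "e \<in> {1, -1}" "d \<in> {1, -1}" and
    g_eq: "g = grid_map sw e d p q" and sym: "design_symmetry D sw e d p q s"
    using planar_group_imp_grid_map[OF g(1)] by metis
  have "Re (g 1 - g 0) = 0" using g(2) unfolding quarter_turn_def by auto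
  then have sw: "sw" using units unfolding g_eq by (auto simp: grid_map_def split: if_splits)
  have "d = - e" using direct[OF sym units] units sw by (auto simp: orientation_reversing_def)
  have shifts: "\<exists>e d q s. e \<in> {1, -1} \<and> d \<in> {1, -1} \<and> \<not> orientation_reversing False e d \<and>
      design_symmetry D False e d k q s" for k
  proof -
    have "warp 0 \<in> strands" "warp k \<in> strands" unfolding strands_def by auto
    then obtain h \<epsilon> where h: "(h, \<epsilon>) \<in> symmetries D" "h ` warp 0 = warp k"
      using iso unfolding isonemal_def by blast
    then have "h \<in> planar_group D" unfolding planar_group_def by force
    then obtain sw' e' d' p' q' s' where units': "e' \<in> {1, -1}" "d' \<in> {1, -1}" and
      h_eq: "h = grid_map sw' e' d' p' q'" and sym': "design_symmetry D sw' e' d' p' q' s'"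
      using planar_group_imp_grid_map by metis
    have "\<not> sw'" "p' = k"
      using h(2) unfolding h_eq grid_map_warp[OF units']
      by (auto simp: warp_eq_iff warp_neq_weft split: if_splits)
    then show ?thesis using units' sym' direct[OF sym' units'] by auto
  qed
  obtain y r where "design_symmetry D False 1 1 2 y r"
    using isonemal_imp_short_translation[OF shifts] by blast
  then show ?thesis
    using order_of_quarter_turn_design[OF _ units(1) \<open>d = - e\<close> _ order] sym sw by auto
qed

section \<open>Block satins\<close>

lemma isonemal_if_planar_group_transitive:
  assumes "\<And>s t. s \<in> strands \<Longrightarrow> t \<in> strands \<Longrightarrow> \<exists>g\<in>planar_group D. g ` s = t"
  shows "isonemal D"
  unfolding isonemal_def
proof (intro ballI)
  fix s t assume "s \<in> strands" "t \<in> strands"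
  then obtain g where "g \<in> planar_group D" "g ` s = t" using assms by blast
  then show "\<exists>(g, \<epsilon>)\<in>symmetries D. g ` s = t" unfolding planar_group_def by force
qed

text \<open>Warps and wefts are linked by composing a motion that fixes the two directions with
  the quarter-turn.\<close>

lemma isonemal_if_quarter_turn:
  assumes col: "\<And>a b. \<exists>e d p q. e \<in> {1, -1} \<and> d \<in> {1, -1} \<and> design_symmetry D False e d p q False \<and> e * a + p = b"
    and row: "\<And>a b. \<exists>e d p q. e \<in> {1, -1} \<and> d \<in> {1, -1} \<and> design_symmetry D False e d p q False \<and> d * a + q = b"
    and quarter: "design_symmetry D True (-1) 1 P Q False"
  shows "isonemal D"
proof -
  have comp: "design_symmetry D True (- d) e (P - q) (Q + p) False"
    if "design_symmetry D False e d p q False" for e d p q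
  proof -
    have "D (- j + P) (i + Q) \<longleftrightarrow> D i j" "D (e * i + p) (d * j + q) \<longleftrightarrow> D i j" for i j
      using quarter that by (simp_all add: design_symmetry_def)
    then have "D (- (d * j + q) + P) (e * i + p + Q) \<longleftrightarrow> D i j" for i j by blast
    then show ?thesis by (simp add: design_symmetry_def algebra_simps)
  qed
  have ww: "\<exists>g\<in>planar_group D. g ` warp a = warp b" for a b
  proof -
    obtain e d p q where *: "e \<in> {1, -1}" "d \<in> {1, -1}" "design_symmetry D False e d p q False" "e * a + p = b"
      using col by meson
    then show ?thesis
      using grid_map_planar_group_iff[OF *(1,2)] grid_map_warp[OF *(1,2), of False]
      by (intro bexI[of _ "grid_map False e d p q"]) auto
  qed
  have ff: "\<exists>g\<in>planar_group D. g ` weft a = weft b" for a b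
  proof -
    obtain e d p q where *: "e \<in> {1, -1}" "d \<in> {1, -1}" "design_symmetry D False e d p q False" "d * a + q = b"
      using row by meson
    then show ?thesis
      using grid_map_planar_group_iff[OF *(1,2)] grid_map_weft[OF *(1,2), of False]
      by (intro bexI[of _ "grid_map False e d p q"]) auto
  qed
  have wf: "\<exists>g\<in>planar_group D. g ` warp a = weft b" for a b
  proof -
    obtain e d p q where *: "e \<in> {1, -1}" "d \<in> {1, -1}" "design_symmetry D False e d p q False" "e * a + p = b - Q"
      using col by meson
    then have u: "- d \<in> {1, -1}" by auto
    show ?thesis
      using grid_map_planar_group_iff[OF u *(1)] comp[OF *(3)] grid_map_warp[OF u *(1), of True] *(4)
      by (intro bexI[of _ "grid_map True (- d) e (P - q) (Q + p)"]) (auto simp: algebra_simps)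
  qed
  have fw: "\<exists>g\<in>planar_group D. g ` weft a = warp b" for a b
  proof -
    obtain e d p q where *: "e \<in> {1, -1}" "d \<in> {1, -1}" "design_symmetry D False e d p q False" "d * a + q = P - b"
      using row by meson
    then have u: "- d \<in> {1, -1}" by auto
    show ?thesis
      using grid_map_planar_group_iff[OF u *(1)] comp[OF *(3)] grid_map_weft[OF u *(1), of True] *(4)
      by (intro bexI[of _ "grid_map True (- d) e (P - q) (Q + p)"]) (auto simp: algebra_simps)
  qed
  show ?thesis
    by (rule isonemal_if_planar_group_transitive) (auto simp: strands_def ww ff wf fw)
qed

lemma type_p4_if_quarter_turn:
  assumes quarter: "design_symmetry D True (-1) 1 P Q s"
    and period: "repeats_every D n" "n > 0"
    and direct: "\<And>sw e d p q s. design_symmetry D sw e d p q s \<Longrightarrow> e \<in> {1, -1} \<Longrightarrow> d \<in> {1, -1} \<Longrightarrow>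
      \<not> orientation_reversing sw e d"
  shows "type_p4 (planar_group D)"
proof -
  have "grid_map True (-1) 1 P Q \<in> planar_group D"
    using grid_map_planar_group_iff[of "-1" 1 True P Q D] quarter by auto
  moreover have "quarter_turn (grid_map True (-1) 1 P Q)"
  proof -
    define c where "c = Complex ((of_int P - of_int Q + 1) / 2) ((of_int P + of_int Q + 1) / 2)"
    have "grid_map True (-1) 1 P Q = (\<lambda>z. c + \<i> * (z - c))"
      by (simp add: fun_eq_iff grid_map_def c_def complex_eq_iff field_simps)
    then show ?thesis unfolding quarter_turn_def by blast
  qed
  moreover have "(\<lambda>z. z + of_nat n) \<in> planar_group D" "(\<lambda>z. z + of_nat n * \<i>) \<in> planar_group D"
  proof -
    have "(\<lambda>z. z + of_nat n) = grid_map False 1 1 (int n) 0"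
      by (simp add: fun_eq_iff grid_map_def complex_eq_iff)
    moreover have "design_symmetry D False 1 1 (int n) 0 False"
      using period by (simp add: repeats_every_def design_symmetry_def)
    ultimately show "(\<lambda>z. z + of_nat n) \<in> planar_group D"
      using grid_map_planar_group_iff[of 1 1] by auto
    have "(\<lambda>z. z + of_nat n * \<i>) = grid_map False 1 1 0 (int n)"
      by (simp add: fun_eq_iff grid_map_def complex_eq_iff)
    moreover have "design_symmetry D False 1 1 0 (int n) False"
      using period by (simp add: repeats_every_def design_symmetry_def)
    ultimately show "(\<lambda>z. z + of_nat n * \<i>) \<in> planar_group D"
      using grid_map_planar_group_iff[of 1 1] by auto
  qed
  moreover have "(of_nat n :: complex) \<noteq> of_nat n * \<i>"
    using period(2) by (simp add: complex_eq_iff)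
  moreover have "independent {of_nat n :: complex, of_nat n * \<i>}"
    by (rule pairwise_orthogonal_independent)
      (use period(2) in \<open>auto simp: pairwise_def orthogonal_def inner_complex_def complex_eq_iff\<close>)
  moreover have "\<not> (reflection g \<or> glide_reflection g)" if "g \<in> planar_group D" for g
    using that direct reflection_imp_orientation_reversing planar_group_imp_grid_map by metis
  ultimately show ?thesis unfolding type_p4_def by blast
qed

text \<open>For \<open>k = 1\<close> and \<open>c\<close> coprime to \<open>m\<close> this is a satin, with one dark cell in every \<open>m\<close> along each
  strand; in general each cell of the satin is enlarged to a block of \<open>k\<close> by \<open>k\<close> cells.\<close>

definition block_satin :: "int \<Rightarrow> int \<Rightarrow> int \<Rightarrow> prefabric" where
  "block_satin k c m i j \<longleftrightarrow> m dvd i div k - c * (j div k)"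

lemma block_satin_translation:
  assumes "k > 0" "m dvd x - c * y"
  shows "design_symmetry (block_satin k c m) False 1 1 (k * x) (k * y) False"
proof -
  have "block_satin k c m (i + k * x) (j + k * y) \<longleftrightarrow> block_satin k c m i j" for i j
  proof -
    have "(i + k * x) div k - c * ((j + k * y) div k) = (i div k - c * (j div k)) + (x - c * y)"
      using assms(1) by (simp add: algebra_simps)
    then show ?thesis unfolding block_satin_def using assms(2) by (simp add: dvd_add_left_iff)
  qed
  then show ?thesis by (simp add: design_symmetry_def)
qed

text \<open>The map \<open>j \<mapsto> k - 1 - j\<close> mirrors the block \<open>0, ..., k - 1\<close> in itself, and therefore carries
  blocks to blocks.\<close>

lemma div_of_mirror_image:
  fixes k j x :: int
  assumes "k > 0"
  shows "(k - 1 - j + k * x) div k = x - j div k"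
proof -
  have "k - 1 - j + k * x = (k - 1 - j mod k) + k * (x - j div k)"
    by (simp add: algebra_simps)
  then have "(k - 1 - j + k * x) div k = ((k - 1 - j mod k) + k * (x - j div k)) div k"
    by (simp only:)
  also have "\<dots> = (x - j div k) + (k - 1 - j mod k) div k"
    using assms by (intro div_mult_self2) simp
  also have "(k - 1 - j mod k) div k = 0"
    using pos_mod_sign[OF assms, of j] pos_mod_bound[OF assms, of j]
    by (intro div_pos_pos_trivial) linarith+
  finally show ?thesis by simp
qed

lemma block_satin_half_turn:
  assumes "k > 0" "m dvd x - c * y"
  shows "design_symmetry (block_satin k c m) False (-1) (-1) (k - 1 + k * x) (k - 1 + k * y) False"
proof -
  have "block_satin k c m (k - 1 - i + k * x) (k - 1 - j + k * y) \<longleftrightarrow> block_satin k c m i j" for i j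
  proof -
    have "(k - 1 - i + k * x) div k - c * ((k - 1 - j + k * y) div k)
        = (x - c * y) - (i div k - c * (j div k))"
      unfolding div_of_mirror_image[OF assms(1)] by (simp add: algebra_simps)
    then show ?thesis unfolding block_satin_def using assms(2) by (metis dvd_diff_right_iff)
  qed
  then show ?thesis by (simp add: design_symmetry_def algebra_simps)
qed

text \<open>The turn is about the centre of the block at the origin. On blocks it multiplies by \<open>i\<close>, which
  acts on \<open>a - c b\<close> as multiplication by \<open>-c\<close>, since \<open>c\<^sup>2 \<equiv> -1\<close>.\<close>

lemma block_satin_quarter_turn:
  assumes "k > 0" "m dvd c\<^sup>2 + 1"
  shows "design_symmetry (block_satin k c m) True (-1) 1 (k - 1) 0 False"
proof -
  have "block_satin k c m (k - 1 - j) i \<longleftrightarrow> block_satin k c m i j" for i j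
  proof -
    define a b where "a = i div k" and "b = j div k"
    have "m dvd - b - c * a \<longleftrightarrow> m dvd a - c * b"
    proof
      assume "m dvd - b - c * a"
      then have "m dvd c * (- b - c * a) + (c\<^sup>2 + 1) * a" using assms(2) by simp
      also have "c * (- b - c * a) + (c\<^sup>2 + 1) * a = a - c * b" by (simp add: power2_eq_square algebra_simps)
      finally show "m dvd a - c * b" .
    next
      assume "m dvd a - c * b"
      then have "m dvd - c * (a - c * b) - (c\<^sup>2 + 1) * b" using assms(2) by (simp add: dvd_diff)
      also have "- c * (a - c * b) - (c\<^sup>2 + 1) * b = - b - c * a" by (simp add: power2_eq_square algebra_simps)
      finally show "m dvd - b - c * a" .
    qed
    moreover have "(k - 1 - j) div k = - b"
      using div_of_mirror_image[OF assms(1), of j 0] by (simp add: b_def)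
    ultimately show ?thesis unfolding block_satin_def a_def b_def by simp
  qed
  then show ?thesis by (simp add: design_symmetry_def algebra_simps)
qed

text \<open>Translations shift a strand only by multiples of \<open>k\<close>, and half-turns supply the shifts that
  mirror the position of the strand within a block. Together they reach every strand only when a
  block has at most two positions.\<close>

lemma block_satin_isonemal:
  assumes k: "k \<in> {1, 2}" and c: "m dvd c\<^sup>2 + 1"
  shows "isonemal (block_satin k c m)"
proof (rule isonemal_if_quarter_turn)
  have kpos: "k > 0" using k by auto
  show "design_symmetry (block_satin k c m) True (-1) 1 (k - 1) 0 False"
    using kpos c by (rule block_satin_quarter_turn)
  have parity: "k dvd b - a \<or> k dvd b + a - (k - 1)" for a b :: int
    using k by auto
  have xc: "m dvd x - c * (- (c * x))" for x
  proof -
    have "x - c * (- (c * x)) = (c\<^sup>2 + 1) * x" by (simp add: power2_eq_square algebra_simps)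
    then show ?thesis using c by simp
  qed
  have xr: "m dvd c * x - c * x" for x by simp
  show "\<exists>e d p q. e \<in> {1, -1} \<and> d \<in> {1, -1} \<and> design_symmetry (block_satin k c m) False e d p q False \<and> e * a + p = b"
    for a b
    using parity[of b a]
  proof
    assume "k dvd b - a"
    then obtain x where "b - a = k * x" by blast
    then show ?thesis using block_satin_translation[OF kpos xc[of x]]
      by (intro exI[of _ 1] exI[of _ "k * x"] exI) auto
  next
    assume "k dvd b + a - (k - 1)"
    then obtain x where "b + a - (k - 1) = k * x" by blast
    then show ?thesis using block_satin_half_turn[OF kpos xc[of x]]
      by (intro exI[of _ "-1"] exI[of _ "k - 1 + k * x"] exI) auto
  qed
  show "\<exists>e d p q. e \<in> {1, -1} \<and> d \<in> {1, -1} \<and> design_symmetry (block_satin k c m) False e d p q False \<and> d * a + q = b"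
    for a b
    using parity[of b a]
  proof
    assume "k dvd b - a"
    then obtain x where "b - a = k * x" by blast
    then have "1 * a + k * x = b" by simp
    then show ?thesis using block_satin_translation[OF kpos xr[of x]] by (metis insert_iff)
  next
    assume "k dvd b + a - (k - 1)"
    then obtain x where "b + a - (k - 1) = k * x" by blast
    then have "-1 * a + (k - 1 + k * x) = b" by simp
    then show ?thesis using block_satin_half_turn[OF kpos xr[of x]] by (metis insert_iff)
  qed
qed

text \<open>Conjugating the translation by \<open>k (c + i)\<close>, an orientation-reversing symmetry yields the
  translation by \<open>k (c - i)\<close> or \<open>k (1 + c i)\<close>, up to sign. In either case \<open>m\<close> divides \<open>2\<close>.\<close>

lemma block_satin_direct:
  assumes k: "k > 0" and c: "m dvd c\<^sup>2 + 1" and m: "m > 2"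
    and sym: "design_symmetry (block_satin k c m) sw e d p q s" and units: "e \<in> {1, -1}" "d \<in> {1, -1}"
  shows "\<not> orientation_reversing sw e d"
proof
  assume rev: "orientation_reversing sw e d"
  have "m dvd c - c * 1" by simp
  from design_symmetry_conjugate_translation[OF sym units block_satin_translation[OF k this]]
  have "block_satin k c m (e * (if sw then k * 1 else k * c)) (d * (if sw then k * c else k * 1))
      \<longleftrightarrow> block_satin k c m 0 0"
    unfolding design_symmetry_def by (metis (no_types, lifting) add.left_neutral mult.right_neutral mult_zero_right)
  then have "block_satin k c m (e * (if sw then k * 1 else k * c)) (d * (if sw then k * c else k * 1))"
    by (simp add: block_satin_def[of k c m 0 0])
  also have "e * (if sw then k * 1 else k * c) = k * (e * (if sw then 1 else c))"
    by (cases sw) (simp_all add: ac_simps)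
  also have "d * (if sw then k * c else k * 1) = k * (d * (if sw then c else 1))"
    by (cases sw) (simp_all add: ac_simps)
  finally have "block_satin k c m (k * (e * (if sw then 1 else c))) (k * (d * (if sw then c else 1)))" .
  then have *: "m dvd e * (if sw then 1 else c) - c * (d * (if sw then c else 1))"
    using k by (simp add: block_satin_def)
  have unit: "m dvd y" if "m dvd e * y" for y using that units(1) by auto
  have "m dvd 2"
  proof (cases sw)
    case True
    then have "m dvd e * (1 - c\<^sup>2)" using * rev by (simp add: orientation_reversing_def power2_eq_square algebra_simps)
    then have "m dvd 1 - c\<^sup>2" by (rule unit)
    then have "m dvd (1 - c\<^sup>2) + (c\<^sup>2 + 1)" using c by (rule dvd_add)
    then show ?thesis by simp
  next
    case False
    then have "m dvd e * (2 * c)" using * rev by (simp add: orientation_reversing_def algebra_simps)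
    then have "m dvd 2 * c" by (rule unit)
    then have "m dvd 2 * (c\<^sup>2 + 1) - c * (2 * c)" by (rule dvd_diff[OF dvd_mult[OF c] dvd_mult])
    then show ?thesis by (simp add: power2_eq_square algebra_simps)
  qed
  then show False using m by (simp add: zdvd_not_zless)
qed

text \<open>A period that is not a multiple of \<open>k\<close> would take cells of a dark block to two consecutive
  blocks of a row; both would be dark, which is impossible for \<open>m > 1\<close>.\<close>

lemma block_satin_order:
  assumes k: "k > 0" and m: "m > 1"
  shows "has_order (block_satin k c m) (nat (k * m))"
proof -
  have km: "k * m > 0" using k m by simp
  have "m dvd m - c * 0" "m dvd 0 - c * m" by simp_all
  from this[THEN block_satin_translation[OF k]]
  have "repeats_every (block_satin k c m) (nat (k * m))"
    using km by (simp add: repeats_every_def design_symmetry_def)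
  moreover have "nat (k * m) \<le> n" if n: "n > 0" "repeats_every (block_satin k c m) n" for n
  proof -
    have per: "block_satin k c m (i + int n) 0 \<longleftrightarrow> block_satin k c m i 0" for i
      using n(2) by (simp add: repeats_every_def)
    have 1: "m dvd int n div k" using per[of 0] by (simp add: block_satin_def)
    have "int n mod k = 0"
    proof (rule ccontr)
      assume nz: "int n mod k \<noteq> 0"
      define r where "r = k - int n mod k"
      have r: "0 < r" "r < k"
        using nz k pos_mod_sign[of k "int n"] pos_mod_bound[of k "int n"] unfolding r_def by linarith+
      have "r + int n = k * (int n div k + 1)"
        unfolding r_def using mult_div_mod_eq[of k "int n"] by (simp add: algebra_simps)
      then have "(r + int n) div k = int n div k + 1" using k by simp
      then have "m dvd int n div k + 1" using per[of r] r by (simp add: block_satin_def)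
      then have "m dvd 1" using 1 by (simp add: dvd_add_right_iff)
      then show False using m by simp
    qed
    then have eq: "int n = k * (int n div k)" using mult_div_mod_eq[of k "int n"] by simp
    then have "k * m dvd int n" using 1 by (metis dvd_refl mult_dvd_mono)
    then show ?thesis using n(1) by (simp add: zdvd_imp_le nat_le_iff)
  qed
  ultimately show ?thesis using km by (simp add: has_order_def)
qed

lemma block_satin_rotational:
  assumes "k > 0" "m dvd c\<^sup>2 + 1" "m > 2"
  shows "rotational_symmetry (block_satin k c m)"
proof -
  have "has_order (block_satin k c m) (nat (k * m))" using assms by (simp add: block_satin_order)
  then have "repeats_every (block_satin k c m) (nat (k * m))" "nat (k * m) > 0"
    by (simp_all add: has_order_def)
  then show ?thesis
    unfolding rotational_symmetry_def
    using type_p4_if_quarter_turn[OF block_satin_quarter_turn[OF assms(1,2)]] block_satin_direct[OF assms] by blast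
qed

section \<open>The orders\<close>

text \<open>For \<open>u N + v M = 1\<close>, the identity \<open>(u M - v N)\<^sup>2 + (u N + v M)\<^sup>2 = (u\<^sup>2 + v\<^sup>2) (M\<^sup>2 + N\<^sup>2)\<close> exhibits a
  square root of \<open>-1\<close>. Adding the odd number \<open>f\<close> if necessary makes it odd, and then it is
  also one modulo \<open>2 f\<close>.\<close>

lemma sqrt_minus_one_modulo_sum_squares:
  fixes M N :: int
  assumes "coprime M N" and f: "f = M\<^sup>2 + N\<^sup>2" "odd f"
  obtains c where "odd c" "f dvd c\<^sup>2 + 1" "2 * f dvd c\<^sup>2 + 1"
proof -
  obtain u v where uv: "u * N + v * M = 1"
    using bezout_int[of N M] assms(1) by (metis coprime_commute coprime_iff_gcd_eq_1)
  define b where "b = u * M - v * N"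
  have "b\<^sup>2 + (u * N + v * M)\<^sup>2 = (u\<^sup>2 + v\<^sup>2) * f"
    unfolding b_def f(1) by (simp add: power2_eq_square algebra_simps)
  then have b: "f dvd b\<^sup>2 + 1" unfolding uv by simp
  define c where "c = (if even b then b + f else b)"
  have "odd c" using f(2) by (simp add: c_def)
  have "f dvd c\<^sup>2 + 1"
  proof (cases "even b")
    case True
    have "c\<^sup>2 + 1 = (b\<^sup>2 + 1) + f * (2 * b + f)"
      using True by (simp add: c_def power2_eq_square algebra_simps)
    then show ?thesis using dvd_add[OF b dvd_triv_left[of f "2 * b + f"]] by (simp only:)
  qed (simp add: b c_def)
  moreover have "2 * f dvd c\<^sup>2 + 1"
    using \<open>odd c\<close> f(2) calculation by (intro divides_mult) auto
  ultimately show thesis using that \<open>odd c\<close> by blast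
qed

theorem theorem10:
  fixes f p :: nat
  assumes "f > 0" and "odd f" and "f * 2 ^ p > 4"
  shows "(\<exists>D :: prefabric. isonemal D \<and> rotational_symmetry D \<and> has_order D (f * 2 ^ p)) \<longleftrightarrow>
         (\<exists>M N :: nat. f = M\<^sup>2 + N\<^sup>2 \<and> gcd M N = 1) \<and> p \<in> {0, 1, 2}"
proof
  assume "\<exists>D :: prefabric. isonemal D \<and> rotational_symmetry D \<and> has_order D (f * 2 ^ p)"
  then obtain u v :: int and k :: nat where uv: "coprime u v" "odd (u\<^sup>2 + v\<^sup>2)" "k \<in> {0, 1, 2}"
    and order: "int (f * 2 ^ p) = (u\<^sup>2 + v\<^sup>2) * 2 ^ k"
    using rotational_isonemal_order by blast
  define M N where "M = nat \<bar>u\<bar>" and "N = nat \<bar>v\<bar>"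
  have MN: "int (M\<^sup>2 + N\<^sup>2) = u\<^sup>2 + v\<^sup>2" by (simp add: M_def N_def)
  have "int (f * 2 ^ p) = int ((M\<^sup>2 + N\<^sup>2) * 2 ^ k)" unfolding order MN[symmetric] by simp
  then have eq: "f * 2 ^ p = (M\<^sup>2 + N\<^sup>2) * 2 ^ k" by (simp only: of_nat_eq_iff)
  have "odd (int (M\<^sup>2 + N\<^sup>2))" unfolding MN by (fact uv(2))
  then have odd: "odd (M\<^sup>2 + N\<^sup>2)" by simp
  have val: "multiplicity 2 (x * 2 ^ j) = j" if "odd x" for x j :: nat
    using that multiplicity_prime_elem_times_other[of 2 x "2 ^ j"] by simp
  have "p = multiplicity 2 (f * 2 ^ p)" using val[OF assms(2), of p] by (rule sym)
  also have "\<dots> = k" unfolding eq using odd by (rule val)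
  finally have "p = k" .
  have "f = M\<^sup>2 + N\<^sup>2" using eq \<open>p = k\<close> by simp
  moreover have "gcd M N = 1"
    using coprime_imp_gcd_eq_1[OF uv(1)] unfolding M_def N_def gcd_int_def by linarith
  ultimately show "(\<exists>M N :: nat. f = M\<^sup>2 + N\<^sup>2 \<and> gcd M N = 1) \<and> p \<in> {0, 1, 2}"
    using uv(3) \<open>p = k\<close> by (intro conjI exI[of _ M] exI[of _ N]) simp_all
next
  assume "(\<exists>M N :: nat. f = M\<^sup>2 + N\<^sup>2 \<and> gcd M N = 1) \<and> p \<in> {0, 1, 2}"
  then obtain M N :: nat where MN: "f = M\<^sup>2 + N\<^sup>2" "gcd M N = 1" and p: "p \<in> {0, 1, 2}"
    by (elim conjE exE)
  have "coprime (int M) (int N)" using MN(2) by (simp add: coprime_iff_gcd_eq_1)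
  moreover have "int f = (int M)\<^sup>2 + (int N)\<^sup>2" unfolding MN(1) by simp
  moreover have "odd (int f)" using assms(2) by simp
  ultimately obtain c where c: "odd c" "int f dvd c\<^sup>2 + 1" "2 * int f dvd c\<^sup>2 + 1"
    by (rule sqrt_minus_one_modulo_sum_squares)
  have "f \<noteq> 1" using p assms(3) by auto
  then have "f > 2" using assms(1,2) by (cases "f = 2") auto
  obtain k m where km: "k \<in> {1, 2}" "m > 2" "m dvd c\<^sup>2 + 1" "k * m = int (f * 2 ^ p)"
  proof -
    \<comment> \<open>Orders \<open>f\<close> and \<open>2 f\<close> come from satins, order \<open>4 f\<close> from blocks of the satin of order \<open>2 f\<close>.\<close>
    from p consider "p = 0" | "p = 1" | "p = 2" by auto
    then show thesis
      using that[of 1 "int f"] that[of 1 "2 * int f"] that[of 2 "2 * int f"] c \<open>f > 2\<close> by cases auto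
  qed
  have "has_order (block_satin k c m) (f * 2 ^ p)"
  proof -
    have "k > 0" "m > 1" using km(1,2) by auto
    then have "has_order (block_satin k c m) (nat (k * m))" by (rule block_satin_order)
    then show ?thesis unfolding km(4) by (simp only: nat_int)
  qed
  moreover have "isonemal (block_satin k c m)" using km by (simp add: block_satin_isonemal)
  moreover have "rotational_symmetry (block_satin k c m)"
    using km by (intro block_satin_rotational) auto
  ultimately show "\<exists>D :: prefabric. isonemal D \<and> rotational_symmetry D \<and> has_order D (f * 2 ^ p)"
    by blast
qed

end
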